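(* Let $\mathbb{F}$ be a field and $n \ge 1$. Let $S_n^{n-1}(x_1,\ldots,x_n) = \sum_{A \subseteq [n], |A| = n-1} \prod_{i \in A} x_i$ be the $n$-variate elementary symmetric polynomial of degree $n-1$. Then $S_n^{n-1}$ cannot be written as a sum of fewer than $\lceil n/2 \rceil$ read-once polynomials over $\mathbb{F}$, but it can be written as a sum of $\lceil n/2 \rceil$ read-once polynomials over $\mathbb{F}$.
   Context: A read-once formula (ROF) over a field $\mathbb{F}$ in variables $x_1,\ldots,x_n$ is a binary tree whose leaves are labeled by variables and whose internal nodes are labeled by $+$ or $\times$; every node additionally carries a pair $(\alpha,\beta) \in \mathbb{F}^2$, and each variable labels at most one leaf. A leaf labeled $x_i$ with pair $(\alpha,\beta)$ computes $\alpha x_i + \beta$; an internal node labeled $\star \in \{+,\times\}$ with pair $(\alpha,\beta)$ whose children compute $f_1,f_2$ computes $\alpha(f_1 \star f_2) + \beta$. A read-once polynomial (ROP) is a polynomial computed by some ROF (constants are also regarded as ROPs). *)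

theory Defs
  imports Complex_Main "HOL-Library.Poly_Mapping"
begin

text \<open>
  Polynomials are formal objects, not functions: a polynomial is a finitely supported map from
  monomials (exponent vectors with finite support) to coefficients, with the convolution product
  of \<^typ>\<open>(nat \<Rightarrow>\<^sub>0 nat) \<Rightarrow>\<^sub>0 'a\<close>. This matters over finite fields.
\<close>

type_synonym 'a mpoly = "(nat \<Rightarrow>\<^sub>0 nat) \<Rightarrow>\<^sub>0 'a"

definition Const :: "'a::zero \<Rightarrow> 'a mpoly" where
  "Const c = Poly_Mapping.single 0 c"

definition Var :: "nat \<Rightarrow> 'a::zero_neq_one mpoly" where
  "Var i = Poly_Mapping.single (Poly_Mapping.single i 1) 1"

datatype gate = Plus | Times

text \<open>The two field arguments of each node are its pair \<open>(\<alpha>, \<beta>)\<close>.\<close>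

datatype 'a formula =
  Leaf nat 'a 'a
| Node gate 'a 'a "'a formula" "'a formula"

fun gate_op :: "gate \<Rightarrow> 'a::comm_ring_1 mpoly \<Rightarrow> 'a mpoly \<Rightarrow> 'a mpoly" where
  "gate_op Plus p q = p + q"
| "gate_op Times p q = p * q"

fun computes :: "'a::comm_ring_1 formula \<Rightarrow> 'a mpoly" where
  "computes (Leaf i \<alpha> \<beta>) = Const \<alpha> * Var i + Const \<beta>"
| "computes (Node g \<alpha> \<beta> F G) = Const \<alpha> * gate_op g (computes F) (computes G) + Const \<beta>"

fun leaf_labels :: "'a formula \<Rightarrow> nat list" where
  "leaf_labels (Leaf i \<alpha> \<beta>) = [i]"
| "leaf_labels (Node g \<alpha> \<beta> F G) = leaf_labels F @ leaf_labels G"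

definition read_once_formula :: "nat \<Rightarrow> 'a formula \<Rightarrow> bool" where
  "read_once_formula n F \<longleftrightarrow> set (leaf_labels F) \<subseteq> {1..n} \<and> distinct (leaf_labels F)"

definition read_once_poly :: "nat \<Rightarrow> 'a::comm_ring_1 mpoly \<Rightarrow> bool" where
  "read_once_poly n p \<longleftrightarrow> (\<exists>c. p = Const c) \<or> (\<exists>F. read_once_formula n F \<and> computes F = p)"

definition sum_of_read_once :: "nat \<Rightarrow> nat \<Rightarrow> 'a::comm_ring_1 mpoly \<Rightarrow> bool" where
  "sum_of_read_once n k p \<longleftrightarrow>
    (\<exists>f :: nat \<Rightarrow> 'a mpoly. (\<forall>i<k. read_once_poly n (f i)) \<and> p = (\<Sum>i<k. f i))"

definition elem_sym :: "nat \<Rightarrow> nat \<Rightarrow> 'a::comm_ring_1 mpoly" where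
  "elem_sym n d = (\<Sum>A | A \<subseteq> {1..n} \<and> card A = d. \<Prod>i\<in>A. Var i)"

end

theory Submission
  imports Defs
begin

text \<open>
  Lower bound: writing a multilinear polynomial as \<open>f\<^sub>0 + x\<^sub>i f\<^sub>1\<close>, the operators
  \<open>f \<mapsto> w f\<^sub>0 + f\<^sub>1\<close> map read-once polynomials to read-once polynomials and map
  \<open>\<alpha> S\<^sub>n\<^sup>n + \<beta> S\<^sub>n\<^sup>n\<^sup>-\<^sup>1\<close> to a polynomial of the same shape in one variable less, with the
  same \<open>\<beta>\<close>. Since \<open>\<beta> \<noteq> 0\<close>, some summand has a nonzero coefficient in degree \<open>n - 1\<close>, and such
  a read-once polynomial is annihilated by two of these operators: a variable it does not
  contain or two variables meeting at a sum gate allow this with derivatives (\<open>w = 0\<close>), and if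
  there are only product gates, the nonzero coefficient forces a leaf \<open>a x + b\<close> with
  \<open>b \<noteq> 0\<close>, which \<open>w = - a / b\<close> kills. Hence two variables can be traded for one summand.
  Upper bound: \<open>S\<^sub>n\<^sup>n\<^sup>-\<^sup>1\<close> is a sum of terms \<open>(x\<^sub>i + x\<^sub>j) \<cdot> \<Prod>\<^sub>k x\<^sub>k\<close> over a pairing of the variables.
\<close>

subsection \<open>Read-once coefficient functions\<close>

text \<open>
  A multilinear polynomial is encoded by the function sending a set \<open>A\<close> to its coefficient at
  the monomial \<open>\<Prod>\<^sub>i\<^sub>\<in>\<^sub>A x\<^sub>i\<close>; in \<open>rop U f\<close> the set \<open>U\<close> collects all leaf labels, so the affine
  maps at the gates arise from constants with \<open>U = {}\<close>.
\<close>

inductive rop :: "nat set \<Rightarrow> (nat set \<Rightarrow> 'a::comm_ring_1) \<Rightarrow> bool" where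
  const: "rop {} (\<lambda>A. if A = {} then c else 0)"
| var: "rop {i} (\<lambda>A. if A = {i} then 1 else 0)"
| add: "rop U f \<Longrightarrow> rop V g \<Longrightarrow> U \<inter> V = {} \<Longrightarrow> rop (U \<union> V) (\<lambda>A. f A + g A)"
| mult: "rop U f \<Longrightarrow> rop V g \<Longrightarrow> U \<inter> V = {} \<Longrightarrow>
    rop (U \<union> V) (\<lambda>A. if A \<subseteq> U \<union> V then f (A \<inter> U) * g (A \<inter> V) else 0)"

text \<open>The polynomial product for disjoint variable sets: a set inside
  \<open>U \<union> V\<close> splits in only one way, so the convolution has a single term.\<close>

definition set_mult ::
    "nat set \<Rightarrow> nat set \<Rightarrow> (nat set \<Rightarrow> 'a::comm_ring_1) \<Rightarrow> (nat set \<Rightarrow> 'a) \<Rightarrow> nat set \<Rightarrow> 'a" where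
  "set_mult U V f g = (\<lambda>A. if A \<subseteq> U \<union> V then f (A \<inter> U) * g (A \<inter> V) else 0)"

text \<open>For a multilinear polynomial \<open>f0 + x_i f1\<close> this gives
  \<open>w f0 + f1\<close>; with \<open>w = 0\<close> it is the partial derivative in
  \<open>x_i\<close>.\<close>

definition contract :: "nat \<Rightarrow> 'a::comm_ring_1 \<Rightarrow> (nat set \<Rightarrow> 'a) \<Rightarrow> nat set \<Rightarrow> 'a" where
  "contract i w f = (\<lambda>A. if i \<in> A then 0 else w * f A + f (insert i A))"

lemmas rop_mult = rop.mult[folded set_mult_def]
lemmas rop_induct = rop.induct[folded set_mult_def, consumes 1, case_names const var add mult]

lemma set_mult_commute: "set_mult U V f g = set_mult V U g f"
  by (simp add: set_mult_def Un_commute mult.commute fun_eq_iff)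

lemma set_mult_zero: "set_mult U V (\<lambda>_. 0) g = (\<lambda>_. 0)"
  by (simp add: set_mult_def fun_eq_iff)

lemma rop_support: "rop U f \<Longrightarrow> \<not> A \<subseteq> U \<Longrightarrow> f A = 0"
proof (induction arbitrary: A rule: rop_induct)
  case (add U f V g)
  then have "\<not> A \<subseteq> U" "\<not> A \<subseteq> V" by auto
  then show ?case using add.IH by simp
qed (auto simp: set_mult_def)

lemma contract_zero: "contract i w (\<lambda>_. 0) = (\<lambda>_. 0)"
  by (simp add: contract_def fun_eq_iff)

lemma contract_add: "contract i w (\<lambda>A. f A + g A) = (\<lambda>A. contract i w f A + contract i w g A)"
  by (simp add: contract_def fun_eq_iff algebra_simps)

lemma contract_sum: "contract i w (\<lambda>A. \<Sum>t\<in>I. f t A) = (\<lambda>A. \<Sum>t\<in>I. contract i w (f t) A)"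
  by (simp add: contract_def fun_eq_iff sum.distrib sum_distrib_left)

text \<open>Only the factor \<open>f\<close> can contain the variable \<open>i\<close>, so
  \<open>g\<close> can be pulled out. If \<open>i\<close> is not in \<open>U\<close> either, the
  contraction just scales by \<open>w\<close>.\<close>

lemma contract_set_mult:
  assumes "rop U f" "i \<notin> V"
  shows "contract i w (set_mult U V f g) = set_mult (U - {i}) V (contract i w f) g"
proof
  fix A
  show "contract i w (set_mult U V f g) A = set_mult (U - {i}) V (contract i w f) g A"
  proof (cases "i \<in> A \<or> \<not> A \<subseteq> U \<union> V")
    case True
    then show ?thesis
      using assms(2) by (auto simp: contract_def set_mult_def)
  next
    case False
    have 1: "A \<inter> (U - {i}) = A \<inter> U" "insert i A \<inter> V = A \<inter> V" "A \<subseteq> U - {i} \<union> V"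
      using False assms(2) by auto
    show ?thesis
    proof (cases "i \<in> U")
      case True
      then show ?thesis
        using False 1 by (auto simp: contract_def set_mult_def algebra_simps)
    next
      case iU: False
      then have "f (insert i (A \<inter> U)) = 0"
        using rop_support[OF assms(1)] by auto
      then show ?thesis
        using False 1 iU assms(2) by (auto simp: contract_def set_mult_def algebra_simps)
    qed
  qed
qed

lemma rop_contract: "rop U f \<Longrightarrow> rop (U - {i}) (contract i w f)"
proof (induction rule: rop_induct)
  case (const c)
  have "contract i w (\<lambda>A. if A = {} then c else 0) = (\<lambda>A. if A = {} then w * c else 0)"
    by (auto simp: contract_def fun_eq_iff)
  then show ?case using rop.const[of "w * c"] by simp
next
  case (var j)
  show ?case
  proof (cases "i = j")
    case True
    have "contract i w (\<lambda>A. if A = {j} then 1 else 0) = (\<lambda>A. if A = {} then 1 else 0)"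
      using True by (auto simp: contract_def fun_eq_iff)
    then show ?thesis using rop.const[of "1::'a"] True by simp
  next
    case False
    \<comment> \<open>Contracting a different variable scales by \<open>w\<close>, which is
      expressed as a product with a constant on the empty variable set.\<close>
    have "contract i w (\<lambda>A. if A = {j} then 1 else 0)
      = set_mult {} {j} (\<lambda>A. if A = {} then w else 0) (\<lambda>A. if A = {j} then 1 else 0)"
      using False by (auto simp: contract_def set_mult_def fun_eq_iff)
    then show ?thesis using rop_mult[OF rop.const[of w] rop.var[of j]] False by simp
  qed
next
  case (add U f V g)
  then have "rop ((U - {i}) \<union> (V - {i})) (\<lambda>A. contract i w f A + contract i w g A)"
    by (intro rop.add) auto
  then show ?case by (simp add: contract_add Un_Diff)
next
  case (mult U f V g)
  show ?case
  proof (cases "i \<in> V")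
    case False
    have "rop ((U - {i}) \<union> V) (set_mult (U - {i}) V (contract i w f) g)"
      using mult False by (intro rop_mult) auto
    then show ?thesis
      using False contract_set_mult[OF mult(1) False] by (simp add: Un_Diff)
  next
    case True
    then have iU: "i \<notin> U" using mult by auto
    have "rop ((V - {i}) \<union> U) (set_mult (V - {i}) U (contract i w g) f)"
      using mult iU by (intro rop_mult) auto
    then show ?thesis
      using iU contract_set_mult[OF mult(2) iU]
      by (simp add: Un_Diff set_mult_commute[of U V] Un_commute)
  qed
qed

lemma contract_outside: "rop U f \<Longrightarrow> i \<notin> U \<Longrightarrow> contract i 0 f = (\<lambda>_. 0)"
  using rop_support[of U f] by (auto simp: contract_def fun_eq_iff)

section \<open>Annihilation by two contractions\<close>

definition killable :: "nat set \<Rightarrow> (nat set \<Rightarrow> 'a::comm_ring_1) \<Rightarrow> bool" where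
  "killable U f \<longleftrightarrow>
    (\<exists>i j w. i \<in> U \<and> j \<in> U \<and> i \<noteq> j \<and> contract i 0 (contract j w f) = (\<lambda>_. 0))"

text \<open>A constant remains constant under the first contraction, and the second one is a
  derivative, so it vanishes.\<close>

lemma killable_add_const:
  assumes "rop {} g" "killable U f"
  shows "killable U (\<lambda>A. f A + g A)"
proof -
  obtain i j w where *: "i \<in> U" "j \<in> U" "i \<noteq> j" "contract i 0 (contract j w f) = (\<lambda>_. 0)"
    using assms(2) by (auto simp: killable_def)
  moreover have "contract i 0 (contract j w g) = (\<lambda>_. 0)"
    using contract_outside[OF rop_contract[OF assms(1)]] by simp
  ultimately have "contract i 0 (contract j w (\<lambda>A. f A + g A)) = (\<lambda>_. 0)"
    by (simp add: contract_add)
  then show ?thesis using * unfolding killable_def by blast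
qed

text \<open>With one variable from each summand, the mixed second derivative vanishes.\<close>

lemma killable_add:
  assumes "rop U f" "rop V g" "U \<inter> V = {}" "U \<noteq> {}" "V \<noteq> {}"
  shows "killable (U \<union> V) (\<lambda>A. f A + g A)"
proof -
  obtain i j where ij: "i \<in> U" "j \<in> V" using assms by auto
  have "contract j 0 f = (\<lambda>_. 0)"
    using assms ij by (intro contract_outside) auto
  moreover have "contract i 0 (contract j 0 g) = (\<lambda>_. 0)"
    using assms ij by (intro contract_outside[OF rop_contract[OF assms(2)]]) auto
  ultimately have "contract i 0 (contract j 0 (\<lambda>A. f A + g A)) = (\<lambda>_. 0)"
    by (simp add: contract_add contract_zero)
  then show ?thesis
    using ij assms(3) unfolding killable_def by (intro exI[of _ i] exI[of _ j] exI[of _ 0]) auto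
qed

lemma killable_set_mult:
  assumes "rop U f" "U \<inter> V = {}" "killable U f"
  shows "killable (U \<union> V) (set_mult U V f g)"
proof -
  obtain i j w where *: "i \<in> U" "j \<in> U" "i \<noteq> j" "contract i 0 (contract j w f) = (\<lambda>_. 0)"
    using assms(3) by (auto simp: killable_def)
  then have "i \<notin> V" "j \<notin> V" using assms(2) by auto
  then have "contract i 0 (contract j w (set_mult U V f g)) = (\<lambda>_. 0)"
    using contract_set_mult[OF assms(1)] contract_set_mult[OF rop_contract[OF assms(1)]] *(4)
    by (simp add: set_mult_zero)
  then show ?thesis using * unfolding killable_def by blast
qed

text \<open>The factor \<open>f\<close> is affine in \<open>x_m\<close> with nonzero constant term,
  so one contraction already kills the product; \<open>V\<close> supplies the second
  variable.\<close>

lemma killable_singleton_mult: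
  fixes f :: "nat set \<Rightarrow> 'a::field"
  assumes "rop {m} f" "m \<notin> V" "V \<noteq> {}" "f {} \<noteq> 0"
  shows "killable (insert m V) (set_mult {m} V f g)"
proof -
  obtain i where i: "i \<in> V" using assms by auto
  define w where "w = - f {m} / f {}"
  have "contract m w f A = 0" for A
  proof (cases "A = {}")
    case False
    have "f A = 0 \<and> f (insert m A) = 0" if "m \<notin> A"
    proof -
      have "\<not> A \<subseteq> {m}" "\<not> insert m A \<subseteq> {m}" using that False by blast+
      then show ?thesis using rop_support[OF assms(1)] by metis
    qed
    then show ?thesis by (simp add: contract_def)
  qed (use assms(4) in \<open>simp add: contract_def w_def\<close>)
  then have "contract m w f = (\<lambda>_. 0)" by auto
  then have "contract i 0 (contract m w (set_mult {m} V f g)) = (\<lambda>_. 0)"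
    using contract_set_mult[OF assms(1,2)] by (simp add: set_mult_zero contract_zero)
  then show ?thesis
    using i assms(2) unfolding killable_def by (intro exI[of _ i] exI[of _ m] exI[of _ w]) auto
qed

text \<open>The coefficient at \<open>U \<union> V - {m}\<close> factors as
  \<open>f (U - {m}) * g V\<close>, so the nonvanishing passes to \<open>f\<close>. If
  \<open>U = {m}\<close>, it says that \<open>f\<close> has a nonzero constant term.\<close>

lemma killable_mult_aux:
  fixes f g :: "nat set \<Rightarrow> 'a::field"
  assumes "rop U f" "U \<inter> V = {}" "m \<in> U"
    and IH: "f (U - {m}) \<noteq> 0 \<Longrightarrow> U = {m} \<or> killable U f"
    and nz: "set_mult U V f g (U \<union> V - {m}) \<noteq> 0"
  shows "U \<union> V = {m} \<or> killable (U \<union> V) (set_mult U V f g)"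
proof -
  have "(U \<union> V - {m}) \<inter> U = U - {m}" by auto
  then have nz': "f (U - {m}) \<noteq> 0" using nz by (auto simp: set_mult_def split: if_splits)
  show ?thesis
  proof (cases "killable U f")
    case True
    then show ?thesis using killable_set_mult[OF assms(1,2)] by blast
  next
    case False
    then have "U = {m}" using IH nz' by blast
    then show ?thesis
      using killable_singleton_mult[of m f V g] assms nz' by (cases "V = {}") auto
  qed
qed

lemma rop_killable:
  fixes f :: "nat set \<Rightarrow> 'a::field"
  shows "rop U f \<Longrightarrow> m \<in> U \<Longrightarrow> f (U - {m}) \<noteq> 0 \<Longrightarrow> U = {m} \<or> killable U f"
proof (induction rule: rop_induct)
  case (const c)
  then show ?case by simp
next
  case (var i)
  then show ?case by simp
next
  case (add U f V g)
  \<comment> \<open>This handles a summand without variables: it does not affect the coefficient at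
    the nonempty set \<open>U - {m}\<close>, so the induction hypothesis for the other summand
    applies.\<close>
  have step: "U = {m} \<or> killable U (\<lambda>A. f A + g A)"
    if "rop {} g" "m \<in> U" "f (U - {m}) + g (U - {m}) \<noteq> 0"
      "f (U - {m}) \<noteq> 0 \<Longrightarrow> U = {m} \<or> killable U f" for U and f g :: "nat set \<Rightarrow> 'a"
  proof (cases "U = {m}")
    case False
    then have "\<not> U - {m} \<subseteq> {}" using that(2) by blast
    then have "g (U - {m}) = 0" by (rule rop_support[OF that(1)])
    then have "killable U f" using that(3,4) False by simp
    then show ?thesis using killable_add_const[OF that(1)] by blast
  qed simp
  consider "V = {}" | "U = {}" | "U \<noteq> {}" "V \<noteq> {}" by blast
  then show ?case
  proof cases
    case 1
    then show ?thesis using step[of g U f] add.hyps add.prems add.IH(1) by simp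
  next
    case 2
    then show ?thesis using step[of f V g] add.hyps add.prems add.IH(2) by (simp add: add.commute)
  next
    case 3
    then show ?thesis using killable_add[OF add(1,2,3)] by blast
  qed
next
  case (mult U f V g)
  show ?case
  proof (cases "m \<in> U")
    case True
    then show ?thesis using killable_mult_aux[of U f V m g] mult by blast
  next
    case False
    then have "m \<in> V" using mult by auto
    moreover have "V \<inter> U = {}" using mult.hyps by blast
    ultimately have "V \<union> U = {m} \<or> killable (V \<union> U) (set_mult V U g f)"
      using mult.hyps(2) mult.IH(2) mult.prems(2)
      unfolding set_mult_commute[of U V] Un_commute[of U V] by (intro killable_mult_aux)
    then show ?thesis unfolding set_mult_commute[of U V] Un_commute[of U V] .
  qed
qed

subsection \<open>Eliminating summands\<close>

text \<open>The coefficients of \<open>\<alpha> S\<^sub>n\<^sup>n + \<beta> S\<^sub>n\<^sup>n\<^sup>-\<^sup>1\<close> in the variables \<open>W\<close>, \<open>n = card W\<close>.\<close>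

definition top_sym :: "nat set \<Rightarrow> 'a::comm_ring_1 \<Rightarrow> 'a \<Rightarrow> nat set \<Rightarrow> 'a" where
  "top_sym W \<alpha> \<beta> A = (if A = W then \<alpha> else if \<exists>m\<in>W. A = W - {m} then \<beta> else 0)"

lemma contract_top_sym:
  assumes "i \<in> W"
  shows "contract i w (top_sym W \<alpha> \<beta>) = top_sym (W - {i}) (w * \<beta> + \<alpha>) \<beta>"
proof
  fix A
  show "contract i w (top_sym W \<alpha> \<beta>) A = top_sym (W - {i}) (w * \<beta> + \<alpha>) \<beta> A"
  proof (cases "i \<in> A")
    case True
    then show ?thesis using assms by (auto simp: contract_def top_sym_def)
  next
    case False
    have 1: "A \<noteq> W" "insert i A = W \<longleftrightarrow> A = W - {i}" using False assms by auto
    \<comment> \<open>Among the monomials that miss one variable, only the one missing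
      \<open>i\<close> avoids \<open>i\<close>; the contraction turns it into the full monomial of
      \<open>W - {i}\<close>, which gives the term \<open>w * \<beta>\<close>.\<close>
    have 2: "(\<exists>m\<in>W. A = W - {m}) \<longleftrightarrow> A = W - {i}" using False assms by auto
    have 3: "(\<exists>m\<in>W. insert i A = W - {m}) \<longleftrightarrow> (\<exists>m\<in>W - {i}. A = W - {i} - {m})"
      using False assms by blast
    show ?thesis using False 1 3 by (simp add: contract_def top_sym_def 2)
  qed
qed

text \<open>Induction on the number of summands: each step removes one summand and two variables.
  \<open>\<alpha>\<close> is generalized because contractions change it, while
  \<open>\<beta>\<close> survives and contradicts the empty sum.\<close>

lemma top_sym_not_sum_rop:
  fixes f :: "'b \<Rightarrow> nat set \<Rightarrow> 'a::field"
  assumes "finite I" "finite W" "2 * card I < card W" "\<beta> \<noteq> 0"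
    and "\<And>t. t \<in> I \<Longrightarrow> \<exists>U\<subseteq>W. rop U (f t)"
  shows "top_sym W \<alpha> \<beta> \<noteq> (\<lambda>A. \<Sum>t\<in>I. f t A)"
  using assms
proof (induction "card I" arbitrary: I W f \<alpha>)
  case 0
  then have "W \<noteq> {}" "I = {}" by auto
  then obtain m where m: "m \<in> W" by blast
  then have "W \<noteq> W - {m}" by blast
  then have "top_sym W \<alpha> \<beta> (W - {m}) \<noteq> 0"
    using m 0 by (auto simp: top_sym_def)
  then show ?case using \<open>I = {}\<close> by (metis sum.empty)
next
  case (Suc k)
  show ?case
  proof
    assume eq: "top_sym W \<alpha> \<beta> = (\<lambda>A. \<Sum>t\<in>I. f t A)"
    \<comment> \<open>This excludes the exceptional case \<open>W = {m}\<close> of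
      \<open>rop_killable\<close>.\<close>
    have cW: "card W > 2" using Suc.hyps(2) Suc.prems(3) by linarith
    then obtain m where m: "m \<in> W" by fastforce
    then have "W - {m} \<noteq> W" by blast
    then have "top_sym W \<alpha> \<beta> (W - {m}) \<noteq> 0"
      using m Suc.prems(4) by (auto simp: top_sym_def)
    then obtain t where t: "t \<in> I" "f t (W - {m}) \<noteq> 0"
      unfolding eq by (meson sum.not_neutral_contains_not_neutral)
    then obtain U where U: "U \<subseteq> W" "rop U (f t)" using Suc.prems(5) by blast
    have "killable W (f t)"
    proof (cases "U = W")
      case True
      moreover have "W \<noteq> {m}" using cW by auto
      ultimately show ?thesis using rop_killable[OF U(2)] m t by blast
    next
      case False
      \<comment> \<open>The derivative in a missing variable \<open>i\<close> is zero, so any other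
        \<open>j\<close> can serve as the second variable.\<close>
      then obtain i where i: "i \<in> W" "i \<notin> U" using U by blast
      have "W \<noteq> {i}" using cW by auto
      then obtain j where j: "j \<in> W" "j \<noteq> i" using i by blast
      have "contract i 0 (contract j 0 (f t)) = (\<lambda>_. 0)"
        using i by (intro contract_outside[OF rop_contract[OF U(2)]]) auto
      then show ?thesis using i j unfolding killable_def by blast
    qed
    then obtain i j w where ij: "i \<in> W" "j \<in> W" "i \<noteq> j"
      and z: "contract i 0 (contract j w (f t)) = (\<lambda>_. 0)"
      unfolding killable_def by blast
    define h where "h = (\<lambda>s. contract i 0 (contract j w (f s)))"
    define W' where "W' = W - {j} - {i}"
    obtain \<alpha>' where "contract i 0 (contract j w (top_sym W \<alpha> \<beta>)) = top_sym W' \<alpha>' \<beta>"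
      using ij by (simp add: contract_top_sym W'_def)
    moreover have "contract i 0 (contract j w (top_sym W \<alpha> \<beta>)) = (\<lambda>A. \<Sum>s\<in>I. h s A)"
      unfolding eq h_def by (simp add: contract_sum)
    moreover have "(\<Sum>s\<in>I. h s A) = (\<Sum>s\<in>I - {t}. h s A)" for A
      using t(1) Suc.prems(1) z by (simp add: sum.remove h_def)
    ultimately have eq': "top_sym W' \<alpha>' \<beta> = (\<lambda>A. \<Sum>s\<in>I - {t}. h s A)" by simp
    have rop: "\<exists>U\<subseteq>W'. rop U (h s)" if s: "s \<in> I - {t}" for s
    proof -
      obtain U where "U \<subseteq> W" "rop U (f s)" using Suc.prems(5)[of s] s by blast
      then have "rop (U - {j} - {i}) (h s)" "U - {j} - {i} \<subseteq> W'"
        unfolding h_def W'_def by (auto intro: rop_contract)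
      then show ?thesis by blast
    qed
    have "card W' = card W - 2" using ij Suc.prems(2) by (simp add: W'_def)
    moreover have "card (I - {t}) = k" using t Suc.hyps(2) by simp
    ultimately have "top_sym W' \<alpha>' \<beta> \<noteq> (\<lambda>A. \<Sum>s\<in>I - {t}. h s A)"
      using Suc.hyps(2) Suc.prems(1-4) by (intro Suc.hyps(1) rop) (auto simp: W'_def)
    then show False using eq' by blast
  qed
qed

subsection \<open>From coefficient functions to polynomials\<close>

definition mono_of :: "nat set \<Rightarrow> (nat \<Rightarrow>\<^sub>0 nat)" where
  "mono_of A = (\<Sum>i\<in>A. Poly_Mapping.single i 1)"

definition expand :: "nat set \<Rightarrow> (nat set \<Rightarrow> 'a::comm_ring_1) \<Rightarrow> 'a mpoly" where
  "expand U f = (\<Sum>A\<in>Pow U. Poly_Mapping.single (mono_of A) (f A))"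

lemma lookup_mono_of: "finite A \<Longrightarrow> Poly_Mapping.lookup (mono_of A) i = (if i \<in> A then 1 else 0)"
  by (induction rule: finite_induct) (auto simp: mono_of_def lookup_add lookup_single when_def)

lemma mono_of_eq_iff: "finite A \<Longrightarrow> finite B \<Longrightarrow> mono_of A = mono_of B \<longleftrightarrow> A = B"
  by (metis lookup_mono_of subset_antisym subsetI zero_neq_one)

lemma mono_of_Un:
  "finite A \<Longrightarrow> finite B \<Longrightarrow> A \<inter> B = {} \<Longrightarrow> mono_of (A \<union> B) = mono_of A + mono_of B"
  by (simp add: mono_of_def sum.union_disjoint)

lemma prod_Var:
  "finite A \<Longrightarrow> (\<Prod>i\<in>A. Var i) = (Poly_Mapping.single (mono_of A) 1 :: 'a::comm_ring_1 mpoly)"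
  by (induction rule: finite_induct) (auto simp: mono_of_def Var_def mult_single)

text \<open>Distinct sets have distinct monomials, so the coefficients inside \<open>W\<close> can
  be read back from the polynomial.\<close>

lemma lookup_expand:
  assumes "finite W" "A \<subseteq> W"
  shows "Poly_Mapping.lookup (expand W f) (mono_of A) = f A"
proof -
  have "Poly_Mapping.lookup (expand W f) (mono_of A)
      = (\<Sum>B\<in>Pow W. if A = B then f B else 0)"
    unfolding expand_def lookup_sum using assms
    by (intro sum.cong) (auto simp: lookup_single when_def mono_of_eq_iff finite_subset)
  then show ?thesis using assms by (simp add: sum.delta)
qed

text \<open>The added coefficients vanish by \<open>rop_support\<close>; this brings all summands to
  a common variable set.\<close>

lemma expand_superset:
  assumes "finite W" "U \<subseteq> W" "rop U f"
  shows "expand U f = expand W f"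
  unfolding expand_def using assms rop_support[OF assms(3)]
  by (intro sum.mono_neutral_left) auto

lemma expand_add: "expand W (\<lambda>A. f A + g A) = expand W f + expand W g"
  by (simp add: expand_def single_add sum.distrib)

lemma expand_sum: "expand W (\<lambda>A. \<Sum>t\<in>I. f t A) = (\<Sum>t\<in>I. expand W (f t))"
proof (induction I rule: infinite_finite_induct)
  case (insert t I)
  then show ?case by (simp add: expand_add)
qed (simp_all add: expand_def)

text \<open>Pairs \<open>(A, B)\<close> correspond bijectively to unions
  \<open>A \<union> B\<close>, with inverse given by intersecting with \<open>U\<close> and
  \<open>V\<close>; hence no two products of terms collide.\<close>

lemma expand_mult:
  assumes "finite U" "finite V" "U \<inter> V = {}"
  shows "expand U f * expand V g = expand (U \<union> V) (set_mult U V f g)"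
proof -
  have "expand U f * expand V g = (\<Sum>(A, B)\<in>Pow U \<times> Pow V.
      Poly_Mapping.single (mono_of A + mono_of B) (f A * g B))"
    by (simp add: expand_def sum_product sum.cartesian_product mult_single)
  also have "\<dots> = (\<Sum>C\<in>Pow (U \<union> V). Poly_Mapping.single (mono_of C) (set_mult U V f g C))"
  proof (rule sum.reindex_bij_witness[of _ "\<lambda>C. (C \<inter> U, C \<inter> V)" "\<lambda>(A, B). A \<union> B"])
    fix p assume "p \<in> Pow U \<times> Pow V"
    then obtain A B where p: "p = (A, B)" "A \<subseteq> U" "B \<subseteq> V" by auto
    then have AB: "finite A" "finite B" "A \<inter> B = {}" "(A \<union> B) \<inter> U = A" "(A \<union> B) \<inter> V = B"
      using assms by (auto dest: finite_subset)
    then show "Poly_Mapping.single (mono_of (case p of (A, B) \<Rightarrow> A \<union> B))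
        (set_mult U V f g (case p of (A, B) \<Rightarrow> A \<union> B))
      = (case p of (A, B) \<Rightarrow> Poly_Mapping.single (mono_of A + mono_of B) (f A * g B))"
      using p by (auto simp: mono_of_Un set_mult_def)
    show "(case (case p of (A, B) \<Rightarrow> A \<union> B) of C \<Rightarrow> (C \<inter> U, C \<inter> V)) = p"
      using AB p by simp
    show "(case p of (A, B) \<Rightarrow> A \<union> B) \<in> Pow (U \<union> V)" using p by auto
  qed auto
  finally show ?thesis by (simp add: expand_def)
qed

definition represented :: "nat set \<Rightarrow> 'a::comm_ring_1 mpoly \<Rightarrow> bool" where
  "represented U p \<longleftrightarrow> finite U \<and> (\<exists>f. rop U f \<and> p = expand U f)"

lemma represented_Const: "represented {} (Const c)"
  unfolding represented_def using rop.const[of c]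
  by (auto simp: expand_def Const_def mono_of_def intro!: exI)

lemma represented_Var: "represented {i} (Var i)"
  unfolding represented_def using rop.var[of i]
  by (auto simp: expand_def Var_def mono_of_def Pow_insert intro!: exI)

lemma represented_add:
  assumes "represented U p" "represented V q" "U \<inter> V = {}"
  shows "represented (U \<union> V) (p + q)"
proof -
  obtain f g where *: "rop U f" "p = expand U f" "rop V g" "q = expand V g" "finite U" "finite V"
    using assms by (auto simp: represented_def)
  then have "p + q = expand (U \<union> V) (\<lambda>A. f A + g A)"
    using expand_superset[of "U \<union> V" U f] expand_superset[of "U \<union> V" V g] by (simp add: expand_add)
  then show ?thesis
    using * rop.add[OF *(1,3) assms(3)] unfolding represented_def by blast
qed

lemma represented_mult:
  assumes "represented U p" "represented V q" "U \<inter> V = {}"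
  shows "represented (U \<union> V) (p * q)"
  using assms expand_mult rop_mult unfolding represented_def by (metis finite_Un)

lemma represented_affine:
  assumes "represented U p"
  shows "represented U (Const a * p + Const b)"
  using represented_add[OF represented_mult[OF represented_Const assms] represented_Const]
  by simp

lemma represented_computes:
  "distinct (leaf_labels F) \<Longrightarrow> represented (set (leaf_labels F)) (computes F)"
proof (induction F)
  case (Leaf i a b)
  then show ?case using represented_affine[OF represented_Var] by simp
next
  case (Node g a b F G)
  then show ?case
    by (cases g) (auto intro!: represented_affine represented_add represented_mult)
qed

lemma represented_read_once: "read_once_poly n p \<Longrightarrow> \<exists>U\<subseteq>{1..n}. represented U p"
  unfolding read_once_poly_def read_once_formula_def
  using represented_Const represented_computes by (metis empty_subsetI)

section \<open>The elementary symmetric polynomial and its lower bound\<close>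

lemma codim_one_sets:
  assumes "n \<ge> 1"
  shows "{A. A \<subseteq> {1..n} \<and> card A = n - 1} = (\<lambda>m. {1..n} - {m}) ` {1..n}"
proof (intro set_eqI iffI)
  fix A assume "A \<in> {A. A \<subseteq> {1..n} \<and> card A = n - 1}"
  then have A: "A \<subseteq> {1..n}" "card A = n - 1" by auto
  then have "card ({1..n} - A) = 1" using assms by (simp add: card_Diff_subset finite_subset)
  then obtain m where "{1..n} - A = {m}" by (auto simp: card_1_singleton_iff)
  then have "A = {1..n} - {m}" "m \<in> {1..n}" using A by auto
  then show "A \<in> (\<lambda>m. {1..n} - {m}) ` {1..n}" by blast
qed auto

lemma elem_sym_expand:
  assumes "n \<ge> 1"
  shows "(elem_sym n (n - 1) :: 'a::comm_ring_1 mpoly) = expand {1..n} (top_sym {1..n} 0 1)"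
proof -
  have *: "top_sym {1..n} 0 1 A = (if A \<in> {A. A \<subseteq> {1..n} \<and> card A = n - 1} then 1 else 0 :: 'a)" for A
    unfolding codim_one_sets[OF assms] top_sym_def by auto
  have "elem_sym n (n - 1) = (\<Sum>A | A \<in> Pow {1..n} \<and> card A = n - 1.
      Poly_Mapping.single (mono_of A) (1::'a))"
    unfolding elem_sym_def by (intro sum.cong) (auto simp: prod_Var finite_subset)
  also have "\<dots> = expand {1..n} (top_sym {1..n} 0 1)"
    unfolding expand_def * by (subst sum.inter_filter) (auto intro!: sum.cong)
  finally show ?thesis .
qed

lemma not_sum_of_read_once_elem_sym:
  assumes "n \<ge> 1" "2 * k < n"
  shows "\<not> sum_of_read_once n k (elem_sym n (n - 1) :: 'a::field mpoly)"
proof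
  assume "sum_of_read_once n k (elem_sym n (n - 1) :: 'a mpoly)"
  then obtain p :: "nat \<Rightarrow> 'a mpoly" where p: "\<forall>t<k. read_once_poly n (p t)"
    and sum: "elem_sym n (n - 1) = (\<Sum>t<k. p t)"
    by (auto simp: sum_of_read_once_def)
  have "\<exists>f. (\<exists>U\<subseteq>{1..n}. rop U f) \<and> p t = expand {1..n} f" if t: "t < k" for t
  proof -
    obtain U f where "U \<subseteq> {1..n}" "rop U f" "p t = expand U f"
      using represented_read_once[of n "p t"] p t unfolding represented_def by blast
    then show ?thesis using expand_superset[of "{1..n}" U f] by auto
  qed
  then obtain f where f: "\<And>t. t < k \<Longrightarrow> \<exists>U\<subseteq>{1..n}. rop U (f t)"
    and pf: "\<And>t. t < k \<Longrightarrow> p t = expand {1..n} (f t)"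
    by metis
  have eq: "expand {1..n} (top_sym {1..n} 0 1) = expand {1..n} (\<lambda>A. \<Sum>t<k. f t A)"
    unfolding expand_sum elem_sym_expand[OF assms(1), symmetric] sum using pf by simp
  \<comment> \<open>The polynomial identity determines coefficients only inside
    \<open>{1..n}\<close>; elsewhere both sides vanish by support.\<close>
  have "top_sym {1..n} 0 1 A = (\<Sum>t<k. f t A)" for A
  proof (cases "A \<subseteq> {1..n}")
    case True
    then show ?thesis
      using arg_cong[OF eq, of "\<lambda>p. Poly_Mapping.lookup p (mono_of A)"] by (simp add: lookup_expand)
  next
    case False
    have "f t A = 0" if t: "t < k" for t
    proof -
      obtain U where U: "U \<subseteq> {1..n}" "rop U (f t)" using f[OF t] by blast
      then have "\<not> A \<subseteq> U" using False by blast
      then show ?thesis by (rule rop_support[OF U(2)])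
    qed
    then show ?thesis using False by (auto simp: top_sym_def)
  qed
  then have "top_sym {1..n} 0 1 = (\<lambda>A. \<Sum>t<k. f t A)" by blast
  then show False
    using top_sym_not_sum_rop[of "{..<k}" "{1..n}" 1 f 0] f assms by auto
qed

subsection \<open>The upper bound\<close>

text \<open>Each new variable is attached by a product gate with pair \<open>(1, 0)\<close>,
  starting from \<open>F\<close>.\<close>

lemma formula_mult_vars:
  assumes "finite S" "distinct (leaf_labels F)" "S \<inter> set (leaf_labels F) = {}"
  shows "\<exists>G. set (leaf_labels G) = set (leaf_labels F) \<union> S \<and> distinct (leaf_labels G)
    \<and> computes G = computes F * (\<Prod>i\<in>S. Var i)"
  using assms
proof (induction S rule: finite_induct)
  case empty
  then show ?case by auto
next
  case (insert i S)
  then obtain G where G: "set (leaf_labels G) = set (leaf_labels F) \<union> S"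
    "distinct (leaf_labels G)" "computes G = computes F * (\<Prod>i\<in>S. Var i)" by auto
  have "computes (Node Times 1 0 G (Leaf i 1 0)) = computes F * (\<Prod>i\<in>insert i S. Var i)"
    using insert G by (simp add: Const_def ac_simps)
  then show ?case
    using G insert by (intro exI[of _ "Node Times 1 0 G (Leaf i 1 0)"]) auto
qed

lemma read_once_poly_mult_vars:
  assumes "S \<subseteq> {1..n}" "read_once_formula n F" "S \<inter> set (leaf_labels F) = {}"
  shows "read_once_poly n (computes F * (\<Prod>i\<in>S. Var i))"
proof -
  have "finite S" using assms(1) by (rule finite_subset) simp
  then obtain G where "set (leaf_labels G) = set (leaf_labels F) \<union> S" "distinct (leaf_labels G)"
    "computes G = computes F * (\<Prod>i\<in>S. Var i)"
    using formula_mult_vars[of S F] assms(2,3) unfolding read_once_formula_def by blast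
  then show ?thesis
    using assms(1,2) unfolding read_once_poly_def read_once_formula_def by (metis Un_least)
qed

lemma read_once_poly_prod_Var:
  assumes "S \<subseteq> {1..n}"
  shows "read_once_poly n (\<Prod>i\<in>S. Var i :: 'a::comm_ring_1 mpoly)"
proof (cases "S = {}")
  \<comment> \<open>The empty product has no leaf to start from, so it is covered by the
    constants.\<close>
  case True
  then have "(\<Prod>i\<in>S. Var i :: 'a mpoly) = Const 1" by (simp add: Const_def)
  then show ?thesis unfolding read_once_poly_def by blast
next
  case False
  then obtain j where j: "j \<in> S" by blast
  have "(\<Prod>i\<in>S. Var i :: 'a mpoly) = computes (Leaf j 1 0) * (\<Prod>i\<in>S - {j}. Var i)"
    using j finite_subset[OF assms] by (simp add: prod.remove Const_def)
  moreover have "read_once_poly n (computes (Leaf j 1 0) * (\<Prod>i\<in>S - {j}. Var i) :: 'a mpoly)"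
    using assms j by (intro read_once_poly_mult_vars) (auto simp: read_once_formula_def)
  ultimately show ?thesis by simp
qed

text \<open>Both products share the factors other than \<open>x_a\<close> and \<open>x_b\<close>, so
  the sum is \<open>x_a + x_b\<close> times the common part.\<close>

lemma read_once_poly_pair:
  fixes P :: "nat \<Rightarrow> 'a::comm_ring_1 mpoly"
  assumes "a \<in> {1..n}" "b \<in> {1..n}" "a \<noteq> b"
    and P: "P = (\<lambda>m. \<Prod>i\<in>{1..n} - {m}. Var i)"
  shows "read_once_poly n (P a + P b)"
proof -
  define S where "S = {1..n} - {a, b}"
  let ?F = "Node Plus 1 0 (Leaf a 1 0) (Leaf b 1 0) :: 'a formula"
  have "{1..n} - {a} = insert b S" "{1..n} - {b} = insert a S" "finite S" "a \<notin> S" "b \<notin> S"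
    using assms by (auto simp: S_def)
  then have "P a + P b = computes ?F * (\<Prod>i\<in>S. Var i)"
    unfolding P by (simp add: Const_def algebra_simps)
  also have "read_once_poly n \<dots>"
    using assms by (intro read_once_poly_mult_vars) (auto simp: read_once_formula_def S_def)
  finally show ?thesis .
qed

lemma sum_pairs:
  fixes Q :: "nat \<Rightarrow> 'a::comm_monoid_add"
  shows "(\<Sum>j = 1..2 * m. Q j) = (\<Sum>t<m. Q (2 * t + 1) + Q (2 * t + 2))"
  by (induction m) (auto simp: ac_simps)

lemma sum_of_read_once_elem_sym:
  assumes "n \<ge> 1"
  shows "sum_of_read_once n ((n + 1) div 2) (elem_sym n (n - 1) :: 'a::comm_ring_1 mpoly)"
proof -
  define P :: "nat \<Rightarrow> 'a mpoly" where "P = (\<lambda>m. \<Prod>i\<in>{1..n} - {m}. Var i)"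
  \<comment> \<open>Zero padding gives the last index a partner \<open>n + 1\<close> when
    \<open>n\<close> is odd.\<close>
  define Q where "Q j = (if j \<le> n then P j else 0)" for j
  have "inj_on (\<lambda>m. {1..n} - {m}) {1..n}" unfolding inj_on_def by blast
  then have "elem_sym n (n - 1) = (\<Sum>j\<in>{1..n}. P j)"
    unfolding elem_sym_def codim_one_sets[OF assms] P_def by (simp add: sum.reindex)
  also have "\<dots> = (\<Sum>j = 1..2 * ((n + 1) div 2). Q j)"
    by (intro sum.mono_neutral_cong_left) (auto simp: Q_def)
  also have "\<dots> = (\<Sum>t<(n + 1) div 2. Q (2 * t + 1) + Q (2 * t + 2))"
    by (rule sum_pairs)
  finally have "elem_sym n (n - 1) = (\<Sum>t<(n + 1) div 2. Q (2 * t + 1) + Q (2 * t + 2))" .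
  moreover have "read_once_poly n (Q (2 * t + 1) + Q (2 * t + 2))" if t: "t < (n + 1) div 2" for t
  proof (cases "2 * t + 2 \<le> n")
    case True
    then have "read_once_poly n (P (2 * t + 1) + P (2 * t + 2))"
      by (intro read_once_poly_pair[OF _ _ _ P_def]) auto
    then show ?thesis using True by (simp add: Q_def)
  next
    \<comment> \<open>Only the last pair for odd \<open>n\<close> remains, where
      \<open>n = 2 * t + 1\<close> and the second term is padding.\<close>
    case False
    moreover have "2 * t + 1 \<le> n" using t by linarith
    ultimately have "Q (2 * t + 1) + Q (2 * t + 2) = (\<Prod>i\<in>{1..n} - {2 * t + 1}. Var i)"
      by (simp add: Q_def P_def)
    then show ?thesis using read_once_poly_prod_Var[of "{1..n} - {2 * t + 1}" n] by simp
  qed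
  ultimately show ?thesis
    unfolding sum_of_read_once_def
    by (intro exI[of _ "\<lambda>t. Q (2 * t + 1) + Q (2 * t + 2)"]) simp
qed

theorem theorem1:
  fixes n :: nat
  assumes "n \<ge> 1"
  shows "(\<forall>k < nat \<lceil>real n / 2\<rceil>. \<not> sum_of_read_once n k (elem_sym n (n - 1) :: 'a::field mpoly))
    \<and> sum_of_read_once n (nat \<lceil>real n / 2\<rceil>) (elem_sym n (n - 1) :: 'a mpoly)"
proof -
  have "nat \<lceil>real n / 2\<rceil> = (n + 1) div 2" by linarith
  moreover have "2 * k < n" if "k < (n + 1) div 2" for k using that by linarith
  ultimately show ?thesis
    using not_sum_of_read_once_elem_sym[OF assms] sum_of_read_once_elem_sym[OF assms] by metis
qed

end
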